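(* Let $\Delta\neq\mathbb{N}$ be a numerical semigroup, let $d\ge2$ be an integer, and let $m=m(\Delta)=\min(\Delta\setminus\{0\})$. Let $\mathcal{M}_d(\Delta)$ be the set of all numerical semigroups $S$ with $S/d=\Delta$. Then $$\max\{\operatorname{rank}_{\mathcal{M}_d(\Delta)}(S): S\in\mathcal{M}_d(\Delta)\}=(d-1)m.$$
   Context: $\mathbb{N}=\{0,1,2,\dots\}$. A numerical semigroup is a submonoid of $(\mathbb{N},+)$ with finite complement in $\mathbb{N}$. For $A\subseteq\mathbb{N}$, $A/d=\{x\in\mathbb{N}: dx\in A\}$ and $dA=\{dx:x\in A\}$; $A+B=\{a+b:a\in A,b\in B\}$; $\langle X\rangle$ is the submonoid of $(\mathbb{N},+)$ generated by $X$. An $\mathcal{M}_d(\Delta)$-monoid is a submonoid $M$ of $(\mathbb{N},+)$ with $M/d=\Delta$. A subset $X\subseteq M$ is an $\mathcal{M}_d(\Delta)$-system of generators of $M$ if $M=\langle X\rangle+d\Delta$; it is minimal if no proper subset of $X$ has this property. Every $\mathcal{M}_d(\Delta)$-monoid $M$ has a unique minimal $\mathcal{M}_d(\Delta)$-system of generators, denoted $\operatorname{msg}_{\mathcal{M}_d(\Delta)}(M)$ (it equals the set of elements of the minimal system of generators of the monoid $M$ that are not in $d\Delta$), and $\operatorname{rank}_{\mathcal{M}_d(\Delta)}(M)=|\operatorname{msg}_{\mathcal{M}_d(\Delta)}(M)|$. *)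

theory Defs
  imports Complex_Main "HOL-Library.Set_Algebras"
begin

definition submonoid_nat :: "nat set \<Rightarrow> bool" where
  "submonoid_nat M \<longleftrightarrow> 0 \<in> M \<and> (\<forall>x\<in>M. \<forall>y\<in>M. x + y \<in> M)"

definition numerical_semigroup :: "nat set \<Rightarrow> bool" where
  "numerical_semigroup S \<longleftrightarrow> submonoid_nat S \<and> finite (- S)"

definition min_pos :: "nat set \<Rightarrow> nat" where
  "min_pos S = (LEAST x. x \<in> S - {0})"

definition quotient_by :: "nat set \<Rightarrow> nat \<Rightarrow> nat set" where
  "quotient_by A d = {x. d * x \<in> A}"

definition dilate :: "nat \<Rightarrow> nat set \<Rightarrow> nat set" where
  "dilate d A = (\<lambda>x. d * x) ` A"

definition gen_submonoid :: "nat set \<Rightarrow> nat set" where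
  "gen_submonoid X = submonoid_nat hull X"

definition md_monoid :: "nat \<Rightarrow> nat set \<Rightarrow> nat set \<Rightarrow> bool" where
  "md_monoid d \<Delta> M \<longleftrightarrow> submonoid_nat M \<and> quotient_by M d = \<Delta>"

definition md_semigroups :: "nat \<Rightarrow> nat set \<Rightarrow> nat set set" where
  "md_semigroups d \<Delta> = {S. numerical_semigroup S \<and> quotient_by S d = \<Delta>}"

(* The plus between sets is the Minkowski sum of HOL-Library.Set_Algebras. *)
definition md_generates :: "nat \<Rightarrow> nat set \<Rightarrow> nat set \<Rightarrow> nat set \<Rightarrow> bool" where
  "md_generates d \<Delta> M X \<longleftrightarrow> X \<subseteq> M \<and> M = gen_submonoid X + dilate d \<Delta>"

definition md_min_generates :: "nat \<Rightarrow> nat set \<Rightarrow> nat set \<Rightarrow> nat set \<Rightarrow> bool" where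
  "md_min_generates d \<Delta> M X \<longleftrightarrow>
     md_generates d \<Delta> M X \<and> (\<forall>Y. Y \<subset> X \<longrightarrow> \<not> md_generates d \<Delta> M Y)"

(* The description is well defined, and the cardinality in md_rank is that of a finite set:
   see ex1_md_min_generates and finite_md_msg. *)
definition md_msg :: "nat \<Rightarrow> nat set \<Rightarrow> nat set \<Rightarrow> nat set" where
  "md_msg d \<Delta> M = (THE X. md_min_generates d \<Delta> M X)"

definition md_rank :: "nat \<Rightarrow> nat set \<Rightarrow> nat set \<Rightarrow> nat" where
  "md_rank d \<Delta> M = card (md_msg d \<Delta> M)"

definition atoms :: "nat set \<Rightarrow> nat set" where
  "atoms M = {x \<in> M - {0}. \<forall>a\<in>M - {0}. \<forall>b\<in>M - {0}. x \<noteq> a + b}"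

lemma submonoid_gen: "submonoid_nat (gen_submonoid X)"
  unfolding gen_submonoid_def by (rule hull_in) (auto simp: submonoid_nat_def)

lemma gen_subset: "X \<subseteq> M \<Longrightarrow> submonoid_nat M \<Longrightarrow> gen_submonoid X \<subseteq> M"
  unfolding gen_submonoid_def by (rule hull_minimal)

lemma submonoid_dilate:
  assumes "md_monoid d \<Delta> M"
  shows "submonoid_nat (dilate d \<Delta>)" and "dilate d \<Delta> \<subseteq> M"
proof -
  have D: "\<Delta> = {x. d * x \<in> M}" and M: "submonoid_nat M"
    using assms by (auto simp: md_monoid_def quotient_by_def)
  show "dilate d \<Delta> \<subseteq> M" by (auto simp: D dilate_def)
  have "0 \<in> \<Delta>" using M by (auto simp: D submonoid_nat_def)
  then have "0 \<in> dilate d \<Delta>" unfolding dilate_def by (metis imageI mult_0_right)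
  moreover have "d * x + d * y \<in> dilate d \<Delta>" if "x \<in> \<Delta>" "y \<in> \<Delta>" for x y
  proof -
    have "x + y \<in> \<Delta>" using that M by (auto simp: D submonoid_nat_def distrib_left)
    then have "d * (x + y) \<in> dilate d \<Delta>" unfolding dilate_def by (rule imageI)
    then show ?thesis by (simp add: distrib_left)
  qed
  ultimately show "submonoid_nat (dilate d \<Delta>)"
    unfolding submonoid_nat_def by (auto simp: dilate_def[of d \<Delta>])
qed

lemma atoms_generate:
  assumes "md_monoid d \<Delta> M"
  shows "md_generates d \<Delta> M (atoms M - dilate d \<Delta>)"
proof -
  let ?X = "atoms M - dilate d \<Delta>" and ?D = "dilate d \<Delta>"
  let ?G = "gen_submonoid ?X + ?D"
  note D = submonoid_dilate[OF assms]
  have M: "submonoid_nat M" using assms by (simp add: md_monoid_def)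
  have X: "?X \<subseteq> M" by (auto simp: atoms_def)
  have z: "0 \<in> gen_submonoid ?X" "0 \<in> ?D"
    using submonoid_gen D by (auto simp: submonoid_nat_def)
  have G: "a + b \<in> ?G" if ab: "a \<in> ?G" "b \<in> ?G" for a b
  proof -
    obtain p q r s where "p \<in> gen_submonoid ?X" "q \<in> ?D" "a = p + q"
      "r \<in> gen_submonoid ?X" "s \<in> ?D" "b = r + s"
      using ab by (auto simp: set_plus_def)
    moreover from this have "p + r \<in> gen_submonoid ?X" "q + s \<in> ?D"
      using submonoid_gen[of ?X] D(1) by (auto simp: submonoid_nat_def)
    moreover have "a + b = (p + r) + (q + s)" using \<open>a = p + q\<close> \<open>b = r + s\<close> by simp
    ultimately show ?thesis using set_plus_intro by metis
  qed
  have "x \<in> ?G" if "x \<in> M" for x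
    using that
  proof (induction x rule: less_induct)
    case (less x)
    consider "x \<in> ?D" | "x \<in> ?X" | a b where "a \<in> M - {0}" "b \<in> M - {0}" "x = a + b"
      using less.prems z(2) unfolding atoms_def by blast
    then show ?case
    proof cases
      case 1
      then show ?thesis using z by (metis add_0 set_plus_intro)
    next
      case 2
      then have "x \<in> gen_submonoid ?X" unfolding gen_submonoid_def by (rule hull_inc)
      then show ?thesis using z by (metis add_0_right set_plus_intro)
    next
      case 3
      then show ?thesis using less.IH[of a] less.IH[of b] G by auto
    qed
  qed
  moreover have "?G \<subseteq> M"
    using gen_subset[OF X M] D(2) M by (auto simp: set_plus_def submonoid_nat_def)
  ultimately show ?thesis using X unfolding md_generates_def by blast
qed

lemma atoms_least:
  assumes "md_monoid d \<Delta> M" and "md_generates d \<Delta> M X"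
  shows "atoms M - dilate d \<Delta> \<subseteq> X"
proof
  fix x assume x: "x \<in> atoms M - dilate d \<Delta>"
  have M: "submonoid_nat M" using assms by (simp add: md_monoid_def)
  have X: "X \<subseteq> M" and eq: "M = gen_submonoid X + dilate d \<Delta>"
    using assms(2) by (auto simp: md_generates_def)
  have gM: "gen_submonoid X \<subseteq> M" using gen_subset[OF X M] .
  have "x \<in> M" using x by (auto simp: atoms_def)
  then obtain p q where pq: "p \<in> gen_submonoid X" "q \<in> dilate d \<Delta>" "x = p + q"
    using eq by (metis set_plus_elim)
  have "p \<in> M" "q \<in> M" using pq gM submonoid_dilate(2)[OF assms(1)] by auto
  then have "p = 0 \<or> q = 0" using x pq by (auto simp: atoms_def)
  then have xg: "x \<in> gen_submonoid X" using x pq by auto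
  show "x \<in> X"
  proof (rule ccontr)
    assume nx: "x \<notin> X"
    have "a + b \<noteq> x" if "a \<in> M - {x}" "b \<in> M - {x}" for a b
      using that x by (cases "a = 0"; cases "b = 0") (auto simp: atoms_def)
    then have sub: "submonoid_nat (M - {x})"
      using x M by (auto simp: submonoid_nat_def atoms_def)
    have "X \<subseteq> M - {x}" using X nx by auto
    then have "gen_submonoid X \<subseteq> M - {x}" using sub by (rule gen_subset)
    then show False using xg by auto
  qed
qed

lemma md_min_generates_iff:
  assumes "md_monoid d \<Delta> M"
  shows "md_min_generates d \<Delta> M X \<longleftrightarrow> X = atoms M - dilate d \<Delta>"
proof -
  let ?A = "atoms M - dilate d \<Delta>"
  have "?A \<subseteq> Y" if "md_generates d \<Delta> M Y" for Y
    using atoms_least[OF assms that] .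
  then show ?thesis
    using atoms_generate[OF assms] unfolding md_min_generates_def by blast
qed

lemma ex1_md_min_generates:
  "md_monoid d \<Delta> M \<Longrightarrow> \<exists>!X. md_min_generates d \<Delta> M X"
  by (simp add: md_min_generates_iff)

lemma md_msg_eq: "md_monoid d \<Delta> M \<Longrightarrow> md_msg d \<Delta> M = atoms M - dilate d \<Delta>"
  unfolding md_msg_def by (rule the_equality) (auto simp: md_min_generates_iff)

lemma finite_atoms:
  assumes M: "submonoid_nat M"
  shows "finite (atoms M)"
proof (cases "M \<subseteq> {0}")
  case True
  then have "atoms M = {}" by (auto simp: atoms_def)
  then show ?thesis by simp
next
  case False
  then obtain n where n: "n \<in> M" "n > 0" by auto
  have mult: "k * n \<in> M" for k
    by (induction k) (use M n in \<open>auto simp: submonoid_nat_def\<close>)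
  have ne: "x mod n \<noteq> y mod n" if "x \<in> atoms M" "y \<in> atoms M" "x < y" for x y
  proof
    assume "x mod n = y mod n"
    then have "n dvd y - x" using that(3) by (metis less_imp_le mod_eq_dvd_iff_nat)
    then obtain k where k: "y - x = k * n" by (metis dvdE mult.commute)
    then have "y = x + k * n" using that(3) by linarith
    moreover from this have "k * n \<in> M - {0}" using that(3) mult by auto
    moreover have "x \<in> M - {0}" "\<forall>a\<in>M - {0}. \<forall>b\<in>M - {0}. y \<noteq> a + b"
      using that(1,2) unfolding atoms_def by blast+
    ultimately show False by metis
  qed
  have "inj_on (\<lambda>x. x mod n) (atoms M)"
    by (rule linorder_inj_onI) (use ne in auto)
  moreover have "(\<lambda>x. x mod n) ` atoms M \<subseteq> {..<n}" using n by auto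
  ultimately show ?thesis by (meson finite_lessThan inj_on_finite)
qed

lemma finite_md_msg: "md_monoid d \<Delta> M \<Longrightarrow> finite (md_msg d \<Delta> M)"
  by (simp add: md_msg_eq finite_atoms md_monoid_def)

end

theory Submission
  imports Defs
begin

text \<open>
  Write \<open>m\<close> for the multiplicity of \<open>\<Delta>\<close>. For the upper bound, \<open>d m \<in> S\<close>, so distinct atoms of \<open>S\<close> are
  incongruent modulo \<open>d m\<close>, and the atoms outside \<open>d \<Delta>\<close> are exactly those not divisible by \<open>d\<close>; this
  leaves \<open>d m - m\<close> residue classes. The bound is attained by adding to \<open>d \<Delta>\<close> all non-multiples of \<open>d\<close>
  from a large multiple \<open>d k\<close> of \<open>d\<close> on: a nonzero element of \<open>d \<Delta>\<close> is at least \<open>d m\<close>, hence every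
  non-multiple of \<open>d\<close> between \<open>d k\<close> and \<open>d k + d m\<close> is an atom.
\<close>

lemma min_pos_in:
  assumes "numerical_semigroup S"
  shows "min_pos S \<in> S" and "min_pos S > 0"
proof -
  have "infinite S"
    using assms by (metis finite_Un Compl_partition infinite_UNIV_nat numerical_semigroup_def)
  then have "\<exists>x. x \<in> S - {0}"
    by (metis equals0I finite.emptyI infinite_remove)
  then have "min_pos S \<in> S - {0}"
    unfolding min_pos_def by (rule LeastI_ex)
  then show "min_pos S \<in> S" "min_pos S > 0" by auto
qed

lemma min_pos_le: "x \<in> S \<Longrightarrow> x > 0 \<Longrightarrow> min_pos S \<le> x"
  unfolding min_pos_def by (rule Least_le) simp

lemma mult_in_submonoid: "submonoid_nat M \<Longrightarrow> n \<in> M \<Longrightarrow> k * n \<in> M"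
  by (induction k) (auto simp: submonoid_nat_def)

text \<open>If two atoms \<open>x < y\<close> were congruent, \<open>y - x\<close> would be a
  positive multiple of \<open>n\<close>, hence a nonzero element of \<open>M\<close>, and
  \<open>y\<close> would split as \<open>x + (y - x)\<close>.\<close>

lemma inj_on_mod_atoms:
  assumes M: "submonoid_nat M" and n: "n \<in> M"
  shows "inj_on (\<lambda>x. x mod n) (atoms M)"
proof (rule linorder_inj_onI)
  fix x y assume xy: "x < y" "x \<in> atoms M" "y \<in> atoms M"
  show "x mod n \<noteq> y mod n"
  proof
    assume "x mod n = y mod n"
    then have "n dvd y - x" using xy(1) by (metis less_imp_le mod_eq_dvd_iff_nat)
    then obtain k where "y - x = k * n" by (metis dvdE mult.commute)
    then have y: "y = x + k * n" using xy(1) by linarith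
    then have "k * n \<in> M - {0}" using xy(1) mult_in_submonoid[OF M n, of k] by auto
    moreover have "x \<in> M - {0}" using xy(2) by (auto simp: atoms_def)
    ultimately show False using y xy(3) unfolding atoms_def by blast
  qed
qed auto

text \<open>Exactly \<open>m\<close> of the \<open>d * m\<close> numbers in the window are multiples
  of \<open>d\<close>. The upper bound uses \<open>k = 0\<close>, where the window is the set of
  residues modulo \<open>d * m\<close>; the lower bound uses a large \<open>k\<close>.\<close>

lemma card_non_multiples:
  fixes d k m :: nat
  assumes "d > 0"
  shows "card {x \<in> {d * k..<d * k + d * m}. \<not> d dvd x} = (d - 1) * m"
proof -
  have *: "{x \<in> {d * k..<d * k + d * m}. \<not> d dvd x}
      = {d * k..<d * k + d * m} - (*) d ` {k..<k + m}"
    using assms by (auto simp flip: distrib_left)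
  have sub: "(*) d ` {k..<k + m} \<subseteq> {d * k..<d * k + d * m}"
    using assms by (auto simp flip: distrib_left)
  have "card ((*) d ` {k..<k + m}) = m"
    using assms by (subst card_image) (auto simp: inj_on_def)
  then show ?thesis
    unfolding * using sub by (simp add: card_Diff_subset diff_mult_distrib)
qed

lemma md_semigroups_monoid: "S \<in> md_semigroups d \<Delta> \<Longrightarrow> md_monoid d \<Delta> S"
  by (simp add: md_semigroups_def md_monoid_def numerical_semigroup_def)

text \<open>An element \<open>d * y\<close> of \<open>M\<close> has \<open>y\<close> in the quotient
  \<Delta>, so within \<open>M\<close> lying in \<open>dilate d \<Delta>\<close> and being divisible
  by \<open>d\<close> are the same.\<close>

lemma md_msg_non_multiples:
  assumes "md_monoid d \<Delta> M"
  shows "md_msg d \<Delta> M = {x \<in> atoms M. \<not> d dvd x}"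
  using assms unfolding md_msg_eq[OF assms]
  by (auto simp: md_monoid_def quotient_by_def dilate_def atoms_def)

lemma md_rank_le:
  assumes M: "md_monoid d \<Delta> M" and d: "d > 0" and m: "m \<in> \<Delta>" "m > 0"
  shows "md_rank d \<Delta> M \<le> (d - 1) * m"
proof -
  have "submonoid_nat M" "d * m \<in> M"
    using M m by (auto simp: md_monoid_def quotient_by_def)
  then have "inj_on (\<lambda>x. x mod (d * m)) {x \<in> atoms M. \<not> d dvd x}"
    by (rule inj_on_subset[OF inj_on_mod_atoms]) auto
  \<comment> \<open>As \<open>d\<close> divides \<open>d * m\<close>, reduction modulo
    \<open>d * m\<close> preserves non-divisibility by \<open>d\<close>.\<close>
  moreover have "(\<lambda>x. x mod (d * m)) ` {x \<in> atoms M. \<not> d dvd x}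
      \<subseteq> {x \<in> {d * 0..<d * 0 + d * m}. \<not> d dvd x}"
    using d m by (auto simp: dvd_mod_iff[of d "d * m"])
  ultimately have "card {x \<in> atoms M. \<not> d dvd x} \<le> card {x \<in> {d * 0..<d * 0 + d * m}. \<not> d dvd x}"
    by (intro card_inj_on_le[of "\<lambda>x. x mod (d * m)"]) auto
  then show ?thesis
    unfolding md_rank_def md_msg_non_multiples[OF M] card_non_multiples[OF d] .
qed

text \<open>Everything from \<open>d * k\<close> on belongs to the set: multiples of
  \<open>d\<close> because \<Delta> contains \<open>{k..}\<close>, the others by construction. This
  gives the finite complement and absorbs every sum with a summand not divisible by
  \<open>d\<close>.\<close>

lemma md_semigroups_witness:
  assumes \<Delta>: "numerical_semigroup \<Delta>" and d: "d > 0" and k: "{k..} \<subseteq> \<Delta>"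
  shows "dilate d \<Delta> \<union> {x. d * k \<le> x \<and> \<not> d dvd x} \<in> md_semigroups d \<Delta>" (is "?S \<in> _")
proof -
  define S where "S = ?S"
  have mem: "x \<in> S \<longleftrightarrow> (if d dvd x then x div d \<in> \<Delta> else d * k \<le> x)" for x
    using d by (auto simp: S_def dilate_def)
  have zero: "0 \<in> \<Delta>" and add: "\<And>a b. a \<in> \<Delta> \<Longrightarrow> b \<in> \<Delta> \<Longrightarrow> a + b \<in> \<Delta>"
    using \<Delta> by (auto simp: numerical_semigroup_def submonoid_nat_def)
  have large: "x \<in> S" if "d * k \<le> x" for x
  proof -
    have "k \<le> x div d" using that d by (simp add: less_eq_div_iff_mult_less_eq mult.commute)
    then show ?thesis using that k unfolding mem by auto
  qed
  have "x + y \<in> S" if xy: "x \<in> S" "y \<in> S" for x y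
  proof (cases "d dvd x \<and> d dvd y")
    case True
    then have "(x + y) div d \<in> \<Delta>"
      using xy add unfolding mem by (simp add: div_plus_div_distrib_dvd_left)
    then show ?thesis using True unfolding mem by simp
  next
    case False
    then have "d * k \<le> x + y" using xy unfolding mem by (auto split: if_splits)
    then show ?thesis by (rule large)
  qed
  moreover have "0 \<in> S" unfolding mem using zero by simp
  moreover have "finite (- S)"
  proof (rule finite_subset)
    show "- S \<subseteq> {..<d * k}" using large by (metis ComplD lessThan_iff not_le subsetI)
  qed simp
  moreover have "quotient_by S d = \<Delta>"
    unfolding quotient_by_def mem using d by simp
  ultimately show ?thesis
    by (simp add: md_semigroups_def numerical_semigroup_def submonoid_nat_def flip: S_def)
qed

text \<open>If a non-multiple of \<open>d\<close> splits into two nonzero elements of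
  \<open>S\<close>, one summand is a non-multiple and so at least \<open>d * k\<close>, while the
  other is at least \<open>d * m\<close>. The sum then lies beyond the window.\<close>

lemma md_rank_witness_ge:
  assumes S: "S \<in> md_semigroups d \<Delta>" and d: "d > 0"
    and S_def: "S = dilate d \<Delta> \<union> {x. d * k \<le> x \<and> \<not> d dvd x}"
    and m: "m \<le> k" "\<And>x. x \<in> \<Delta> \<Longrightarrow> x > 0 \<Longrightarrow> m \<le> x"
  shows "(d - 1) * m \<le> md_rank d \<Delta> S"
proof -
  have "{x \<in> {d * k..<d * k + d * m}. \<not> d dvd x} \<subseteq> md_msg d \<Delta> S"
  proof
    fix x assume "x \<in> {x \<in> {d * k..<d * k + d * m}. \<not> d dvd x}"
    then have x: "d * k \<le> x" "x < d * k + d * m" "\<not> d dvd x" by auto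
    \<comment> \<open>Multiples of \<open>d\<close> in \<open>S\<close> come from \<Delta>, whose
      positive elements are at least \<open>m\<close>; for non-multiples the bound comes from
      \<open>m \<le> k\<close>.\<close>
    have mult: "d * m \<le> a" if "a \<in> S - {0}" for a
    proof (cases "d dvd a")
      case True
      with that show ?thesis using m d by (auto simp: S_def dilate_def)
    next
      case False
      then have "d * k \<le> a" using that by (auto simp: S_def dilate_def)
      then show ?thesis using m(1) by (meson le_trans mult_le_mono2)
    qed
    have "x \<noteq> a + b" if "a \<in> S - {0}" "b \<in> S - {0}" for a b
    proof
      assume ab: "x = a + b"
      then have "\<not> d dvd a \<or> \<not> d dvd b" using x(3) by auto
      then have "d * k \<le> a \<or> d * k \<le> b" using that by (auto simp: S_def dilate_def)
      then show False using ab x(2) mult[OF that(1)] mult[OF that(2)] by linarith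
    qed
    moreover have "x \<in> S - {0}" using x by (auto simp: S_def intro: ccontr)
    ultimately show "x \<in> md_msg d \<Delta> S"
      using x(3) unfolding md_msg_non_multiples[OF md_semigroups_monoid[OF S]] atoms_def by blast
  qed
  then have "card {x \<in> {d * k..<d * k + d * m}. \<not> d dvd x} \<le> md_rank d \<Delta> S"
    unfolding md_rank_def by (intro card_mono finite_md_msg md_semigroups_monoid[OF S])
  then show ?thesis unfolding card_non_multiples[OF d] .
qed

theorem proposition4p8:
  fixes \<Delta> :: "nat set" and d :: nat
  assumes "numerical_semigroup \<Delta>" and "\<Delta> \<noteq> UNIV" and "d \<ge> 2"
  shows "finite (md_rank d \<Delta> ` md_semigroups d \<Delta>) \<and>
         md_rank d \<Delta> ` md_semigroups d \<Delta> \<noteq> {} \<and>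
         Max (md_rank d \<Delta> ` md_semigroups d \<Delta>) = (d - 1) * min_pos \<Delta>"
proof -
  let ?m = "min_pos \<Delta>"
  have d: "d > 0" using assms(3) by simp
  have le: "md_rank d \<Delta> S \<le> (d - 1) * ?m" if "S \<in> md_semigroups d \<Delta>" for S
    using md_rank_le[OF md_semigroups_monoid[OF that] d] min_pos_in[OF assms(1)] by blast
  then have fin: "finite (md_rank d \<Delta> ` md_semigroups d \<Delta>)"
    by (auto intro: finite_subset[of _ "{..(d - 1) * ?m}"])
  obtain c where c: "\<And>x. x \<in> - \<Delta> \<Longrightarrow> x < c"
    using assms(1) unfolding numerical_semigroup_def by (metis finite_nat_set_iff_bounded)
  \<comment> \<open>\<open>c\<close> puts \<open>k\<close> beyond all gaps of \<Delta>, and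
    \<open>?m\<close> ensures that the non-multiples added to \<open>S\<close> are at least
    \<open>d * ?m\<close>.\<close>
  define k where "k = max c ?m"
  define S where "S = dilate d \<Delta> \<union> {x. d * k \<le> x \<and> \<not> d dvd x}"
  have "{k..} \<subseteq> \<Delta>" using c by (force simp: k_def)
  then have S: "S \<in> md_semigroups d \<Delta>"
    unfolding S_def by (rule md_semigroups_witness[OF assms(1) d])
  have "(d - 1) * ?m \<le> md_rank d \<Delta> S"
    by (rule md_rank_witness_ge[OF S d S_def]) (auto simp: k_def min_pos_le)
  then have "(d - 1) * ?m \<in> md_rank d \<Delta> ` md_semigroups d \<Delta>"
    using le[OF S] S by (metis antisym imageI)
  then show ?thesis
    using fin le by (auto intro!: Max_eqI)
qed

end
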